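(* Let $b\ge 2$, $k\ge 1$, $n\ge 1$ be integers, and let $N_k=b^{2^{k}}-1$. Assume that $n=2^q p$ with $p$ an odd positive integer and $q\ge 0$ an integer, that $b\ge \binom{2n}{n}$, and that $b=(4\ell+2)p+1$ for some integer $\ell\ge 0$. Then $N_k$ is a degree $2n$ $b$-Niven number. In particular, for every even degree $m\ge 2$, there exist infinitely many bases $b\ge 2$ for which there exist degree $m$ $b$-Niven numbers all of whose base $b$ digits are different from zero.
   Context: For an integer base $b\ge 2$ and a positive integer $N$, let $s_b(N)$ denote the sum of the base $b$ digits of $N$. A positive integer $N$ is a $b$-Niven number if $s_b(N)$ divides $N$. For an integer $m\ge 1$, a positive integer $N$ is a degree $m$ $b$-Niven number if both $N$ and $N^m$ are $b$-Niven numbers. *)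

theory Defs
  imports Complex_Main
begin

text \<open>
  The base \<open>b\<close> digits of \<open>n\<close>, least significant digit first and without leading zeros;
  in particular \<open>0\<close> has no digits. Only bases \<open>b \<ge> 2\<close> are meaningful; the test \<open>b < 2\<close> is there
  for termination.
\<close>

fun base_digits :: "nat \<Rightarrow> nat \<Rightarrow> nat list" where
  "base_digits b n = (if b < 2 \<or> n = 0 then [] else n mod b # base_digits b (n div b))"

declare base_digits.simps [simp del]

definition digit_sum :: "nat \<Rightarrow> nat \<Rightarrow> nat" where
  "digit_sum b n = sum_list (base_digits b n)"

definition niven :: "nat \<Rightarrow> nat \<Rightarrow> bool" where
  "niven b N \<longleftrightarrow> N > 0 \<and> digit_sum b N dvd N"

definition niven_of_degree :: "nat \<Rightarrow> nat \<Rightarrow> nat \<Rightarrow> bool" where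
  "niven_of_degree m b N \<longleftrightarrow> niven b N \<and> niven b (N ^ m)"

lemma base_digits_less:
  assumes "d \<in> set (base_digits b n)"
  shows "d < b"
  using assms
proof (induction b n rule: base_digits.induct)
  case (1 b n)
  have "d \<in> set (if b < 2 \<or> n = 0 then [] else n mod b # base_digits b (n div b))"
    using "1.prems" base_digits.simps[of b n] by simp
  then show ?case
    using "1.IH" by (auto split: if_splits)
qed

lemma horner_sum_base_digits:
  assumes "b \<ge> 2"
  shows "horner_sum id b (base_digits b n) = n"
  using assms
proof (induction b n rule: base_digits.induct)
  case (1 b n)
  then show ?case
    by (simp add: base_digits.simps[of b n])
qed

lemma last_base_digits_nonzero:
  assumes "base_digits b n \<noteq> []"
  shows "last (base_digits b n) \<noteq> 0"
  using assms
proof (induction b n rule: base_digits.induct)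
  case (1 b n)
  have *: "b \<ge> 2" "n > 0"
    using "1.prems" by (subst (asm) base_digits.simps, simp split: if_splits)+
  then have eq: "base_digits b n = n mod b # base_digits b (n div b)"
    by (subst base_digits.simps) simp
  show ?case
  proof (cases "base_digits b (n div b) = []")
    case True
    then have "n div b = 0"
      using * by (subst (asm) base_digits.simps) (simp split: if_splits)
    then have "n < b"
      using * by (simp add: div_eq_0_iff)
    then show ?thesis
      using eq True * by simp
  next
    case False
    then show ?thesis
      using eq "1.IH" * by simp
  qed
qed

end

(*
  Put B = b ^ M, M = 2 ^ k and N = B - 1. Expanding N ^ (2 n) by the binomial theorem and
  pairing the term of degree 2 i + 1 with that of degree 2 i + 2, the borrow turns the coefficients
  into the base B digits 1, B - C(2n,1), C(2n,2) - 1, B - C(2n,3), ..., C(2n,2n) - 1.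
  As C(2n,j) - 1 < b, this number is a single base b digit, and B - C(2n,j) = (B - 1) - (C(2n,j) - 1)
  has digit sum M (b - 1) - (C(2n,j) - 1). The alternating sum of the binomial coefficients
  vanishes, so the digit sum of N ^ (2 n) is n M (b - 1), which divides N ^ (2 n) because
  M (b - 1) and p divide N, and 2 ^ q divides N ^ (2 n - 2).
*)

theory Submission
  imports Defs "HOL-Library.Infinite_Set"
begin

section \<open>Digit sums of concatenations and complements\<close>

lemma base_digits_add_mult:
  assumes "b \<ge> 2" "x < b" "x + b * y > 0"
  shows "base_digits b (x + b * y) = x # base_digits b y"
  using assms by (subst base_digits.simps) auto

lemma base_digits_power_diff_1:
  assumes "b \<ge> 2"
  shows "base_digits b (b ^ M - 1) = replicate M (b - 1)"
proof (induction M)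
  case 0
  show ?case by (simp add: base_digits.simps)
next
  case (Suc M)
  have "b * b ^ M - 1 = (b - 1) + b * (b ^ M - 1)"
    using assms by (simp add: right_diff_distrib')
  then show ?case
    using base_digits_add_mult[of b "b - 1" "b ^ M - 1"] assms Suc.IH by simp
qed

lemma digit_sum_0 [simp]: "digit_sum b 0 = 0"
  by (simp add: digit_sum_def base_digits.simps)

lemma digit_sum_add_mult:
  assumes "b \<ge> 2" "x < b"
  shows "digit_sum b (x + b * y) = x + digit_sum b y"
\<comment> \<open>\<open>base_digits b 0\<close> is empty rather than \<open>[0]\<close>, so the
  zero case is separate.\<close>
proof (cases "x + b * y > 0")
  case True
  then show ?thesis
    using base_digits_add_mult[of b x y] assms by (simp add: digit_sum_def)
next
  case False
  with assms have "x = 0" "y = 0" by auto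
  then show ?thesis by simp
qed

lemma digit_sum_less_base:
  assumes "b \<ge> 2" "x < b"
  shows "digit_sum b x = x"
  using digit_sum_add_mult[OF assms, of 0] by simp

lemma digit_sum_power_diff_1:
  assumes "b \<ge> 2"
  shows "digit_sum b (b ^ M - 1) = M * (b - 1)"
  using base_digits_power_diff_1[OF assms] by (simp add: digit_sum_def sum_list_replicate)

text \<open>No carries occur: \<open>x\<close> occupies the lowest \<open>M\<close> places and
  \<open>y\<close> those above. The induction strips the lowest digit of \<open>x\<close>, which
  shortens the shift of \<open>y\<close> by one place.\<close>

lemma digit_sum_add_power_mult:
  assumes "b \<ge> 2" "x < b ^ M"
  shows "digit_sum b (x + b ^ M * y) = digit_sum b x + digit_sum b y"
  using assms(2)
proof (induction M arbitrary: x)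
  case 0
  then show ?case by simp
next
  case (Suc M)
  define r s where "r = x mod b" and "s = x div b"
  have x: "x = r + b * s" and r: "r < b"
    using assms(1) by (simp_all add: r_def s_def)
  have s: "s < b ^ M"
    using Suc.prems by (simp add: s_def less_mult_imp_div_less mult.commute)
  have "x + b ^ Suc M * y = r + b * (s + b ^ M * y)"
    by (simp add: x algebra_simps)
  then have "digit_sum b (x + b ^ Suc M * y) = r + (digit_sum b s + digit_sum b y)"
    by (simp only: digit_sum_add_mult[OF assms(1) r] Suc.IH[OF s])
  then show ?case
    by (simp add: x digit_sum_add_mult[OF assms(1) r])
qed

text \<open>Iterates the two-block case: each \<open>w i\<close>, padded to \<open>L\<close> places,
  is a separate stretch of the expansion.\<close>

lemma digit_sum_blocks:
  assumes "b \<ge> 2" "\<And>i. i < n \<Longrightarrow> w i < b ^ L"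
  shows "digit_sum b (\<Sum>i<n. w i * (b ^ L) ^ i) = (\<Sum>i<n. digit_sum b (w i))"
  using assms(2)
proof (induction n arbitrary: w)
  case 0
  then show ?case by simp
next
  case (Suc n)
  have "(\<Sum>i<Suc n. w i * (b ^ L) ^ i) = w 0 + b ^ L * (\<Sum>i<n. w (Suc i) * (b ^ L) ^ i)"
    unfolding sum.lessThan_Suc_shift by (simp add: sum_distrib_left mult_ac)
  moreover have "digit_sum b (\<Sum>i<n. w (Suc i) * (b ^ L) ^ i) = (\<Sum>i<n. digit_sum b (w (Suc i)))"
    by (rule Suc.IH) (simp add: Suc.prems)
  ultimately show ?case
    using digit_sum_add_power_mult[OF assms(1) Suc.prems[of 0]]
    unfolding sum.lessThan_Suc_shift by simp
qed

text \<open>Subtracting from \<open>b ^ M - 1\<close>, all of whose digits are \<open>b - 1\<close>,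
  needs no borrow: each digit \<open>d\<close> of \<open>x\<close>, padded to \<open>M\<close>
  places, becomes \<open>b - 1 - d\<close>.\<close>

lemma digit_sum_complement:
  assumes "b \<ge> 2" "x < b ^ M"
  shows "digit_sum b (b ^ M - 1 - x) + digit_sum b x = M * (b - 1)"
  using assms(2)
proof (induction M arbitrary: x)
  case 0
  then show ?case by simp
next
  case (Suc M)
  define r s where "r = x mod b" and "s = x div b"
  have x: "x = r + b * s" and r: "r < b"
    using assms(1) by (simp_all add: r_def s_def)
  have s: "s < b ^ M"
    using Suc.prems by (simp add: s_def less_mult_imp_div_less mult.commute)
  \<comment> \<open>\<open>t\<close> replaces the truncated difference
    \<open>b ^ M - 1 - s\<close>.\<close>
  obtain t where t: "b ^ M = t + s + 1"
    using less_imp_Suc_add[OF s] by auto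
  have "b ^ Suc M - 1 - x = (b - 1 - r) + b * (b ^ M - 1 - s)"
    using r by (simp add: x t algebra_simps)
  then have "digit_sum b (b ^ Suc M - 1 - x) = (b - 1 - r) + digit_sum b (b ^ M - 1 - s)"
    using digit_sum_add_mult[of b "b - 1 - r"] assms(1) by simp
  then show ?case
    using Suc.IH[OF s] digit_sum_add_mult[OF assms(1) r, of s] r by (simp add: x)
qed

section \<open>Binomial expansion of the even power and its digit sum\<close>

lemma sum_atMost_double:
  fixes f :: "nat \<Rightarrow> 'a :: comm_monoid_add"
  shows "(\<Sum>j\<le>2 * n. f j) = f 0 + (\<Sum>i<n. f (2 * i + 1) + f (2 * i + 2))"
  by (induction n) (simp_all add: add.assoc)

text \<open>With \<open>c\<close> and \<open>d\<close> the binomial coefficients at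
  \<open>2 * i + 1\<close> and \<open>2 * i + 2\<close>, these two terms add up to
  \<open>B ^ (2 * i + 1) * (B * d - c)\<close>. Borrowing one \<open>B\<close> turns the bracket
  into \<open>(B - c) + B * (d - 1)\<close>, which has no negative part.\<close>

lemma power_diff_1_blocks:
  fixes B :: nat
  assumes "B > 0" "(2 * n) choose n \<le> B"
  shows "(B - 1) ^ (2 * n) = 1 + B * (\<Sum>i<n.
           ((B - (2 * n choose (2 * i + 1))) + B * ((2 * n choose (2 * i + 2)) - 1)) * (B ^ 2) ^ i)"
    (is "_ = 1 + B * (\<Sum>i<n. ?w i * _)")
proof -
  let ?C = "\<lambda>j. int (2 * n choose j)"
  define f where "f j = (-1) ^ j * ?C j * int B ^ j" for j
  have pair: "f (2 * i + 1) + f (2 * i + 2) = int B * (int (?w i) * (int B ^ 2) ^ i)"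
    if "i < n" for i
  proof -
    have "2 * n choose (2 * i + 1) \<le> B"
      using binomial_maximum[of "2 * n" "2 * i + 1"] assms(2) by simp
    moreover have "1 \<le> 2 * n choose (2 * i + 2)"
      using that zero_less_binomial[of "2 * i + 2" "2 * n"] by linarith
    \<comment> \<open>The two bounds make the truncated subtractions exact.\<close>
    ultimately have w: "int (?w i) = int B - ?C (2 * i + 1) + int B * (?C (2 * i + 2) - 1)"
      by (simp add: of_nat_diff)
    show ?thesis
      unfolding w f_def
      by (simp add: power_add power_mult algebra_simps power2_eq_square)
  qed
  \<comment> \<open>As the exponent is even, \<open>B - 1\<close> may be replaced by
    \<open>1 - B\<close>, which attaches the signs to the powers of \<open>B\<close>.\<close>
  have "int ((B - 1) ^ (2 * n)) = (- 1 * int B + 1) ^ (2 * n)"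
    using assms(1) by (simp add: of_nat_diff power_mult power2_commute)
  also have "\<dots> = (\<Sum>j\<le>2 * n. f j)"
    unfolding binomial_ring f_def by (intro sum.cong) (auto simp: power_mult_distrib power_minus[of "int B"])
  also have "\<dots> = f 0 + (\<Sum>i<n. f (2 * i + 1) + f (2 * i + 2))"
    by (rule sum_atMost_double)
  also have "\<dots> = 1 + (\<Sum>i<n. int B * (int (?w i) * (int B ^ 2) ^ i))"
    using pair by (simp add: f_def)
  also have "\<dots> = int (1 + B * (\<Sum>i<n. ?w i * (B ^ 2) ^ i))"
    by (simp only: sum_distrib_left of_nat_add of_nat_mult of_nat_sum of_nat_power of_nat_1)
  finally show ?thesis
    by (simp only: of_nat_eq_iff)
qed

lemma digit_sum_power_diff_1_even_power:
  assumes b: "b \<ge> 2" "(2 * n) choose n \<le> b" and "M > 0" "n > 0"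
  shows "digit_sum b ((b ^ M - 1) ^ (2 * n)) = n * M * (b - 1)"
proof -
  define B where "B = b ^ M"
  define C where "C j = 2 * n choose j" for j
  define w where "w i = (B - C (2 * i + 1)) + B * (C (2 * i + 2) - 1)" for i
  have bB: "b \<le> B"
    unfolding B_def using assms by (intro self_le_power) auto
  have C: "1 \<le> C j" "C j \<le> b" if "j \<le> 2 * n" for j
    using that zero_less_binomial[of j "2 * n"] binomial_maximum[of "2 * n" j] b(2)
    unfolding C_def by (simp_all add: Suc_le_eq)
  have w: "w i < b ^ (2 * M)" and
    ds: "int (digit_sum b (w i)) = int (M * (b - 1)) - int (C (2 * i + 1)) + int (C (2 * i + 2))"
    if "i < n" for i
  proof -
    have c: "1 \<le> C (2 * i + 1)" "C (2 * i + 1) \<le> b" "1 \<le> C (2 * i + 2)" "C (2 * i + 2) \<le> b"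
      using C that by auto
    have lt: "B - C (2 * i + 1) < B"
      using c b(1) bB by auto
    have "w i < B + B * (C (2 * i + 2) - 1)"
      using lt by (simp add: w_def)
    also have "\<dots> = B * C (2 * i + 2)"
      using c by (cases "C (2 * i + 2)") auto
    also have "\<dots> \<le> B * B"
      using c bB by (intro mult_left_mono) auto
    finally show "w i < b ^ (2 * M)"
      by (simp add: B_def mult_2 power_add)
    \<comment> \<open>The two base \<open>B\<close> digits of \<open>w i\<close> are
      \<open>B - C (2 * i + 1)\<close> and \<open>C (2 * i + 2) - 1\<close>.\<close>
    have "digit_sum b (w i) = digit_sum b (B - C (2 * i + 1)) + digit_sum b (C (2 * i + 2) - 1)"
      unfolding w_def using digit_sum_add_power_mult[OF b(1), of _ M] lt by (simp add: B_def)
    \<comment> \<open>Diminished by 1, a coefficient is a single base \<open>b\<close> digit even if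
      it equals \<open>b\<close>.\<close>
    moreover have "digit_sum b (C (2 * i + 2) - 1) = C (2 * i + 2) - 1"
      using c b(1) by (intro digit_sum_less_base) auto
    moreover have "digit_sum b (C (2 * i + 1) - 1) = C (2 * i + 1) - 1"
      using c b(1) by (intro digit_sum_less_base) auto
    moreover have "digit_sum b (B - C (2 * i + 1)) + digit_sum b (C (2 * i + 1) - 1) = M * (b - 1)"
    proof -
      have "B - C (2 * i + 1) = b ^ M - 1 - (C (2 * i + 1) - 1)"
        using c bB by (simp add: B_def)
      moreover have "C (2 * i + 1) - 1 < b ^ M"
        using c bB unfolding B_def by linarith
      ultimately show ?thesis
        using digit_sum_complement[OF b(1)] by presburger
    qed
    ultimately show
      "int (digit_sum b (w i)) = int (M * (b - 1)) - int (C (2 * i + 1)) + int (C (2 * i + 2))"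
      using c by linarith
  qed
  have "(B - 1) ^ (2 * n) = 1 + B * (\<Sum>i<n. w i * (B ^ 2) ^ i)"
    unfolding w_def C_def using b bB by (intro power_diff_1_blocks) auto
  then have "(b ^ M - 1) ^ (2 * n) = 1 + b ^ M * (\<Sum>i<n. w i * (b ^ (2 * M)) ^ i)"
    by (simp add: B_def power_mult [symmetric] mult.commute)
  moreover have "1 < b ^ M"
    using b(1) bB by (simp add: B_def)
  \<comment> \<open>The lowest base \<open>B\<close> digit 1 fills \<open>M\<close> places; each
    block above it fills \<open>2 * M\<close>.\<close>
  ultimately have
    "digit_sum b ((b ^ M - 1) ^ (2 * n)) = 1 + (\<Sum>i<n. digit_sum b (w i))"
    using digit_sum_add_power_mult[OF b(1), of 1 M] digit_sum_blocks[OF b(1), of n w "2 * M"] w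
      digit_sum_less_base[OF b(1), of 1] b(1) by simp
  then have "int (digit_sum b ((b ^ M - 1) ^ (2 * n))) =
      1 + (\<Sum>i<n. int (M * (b - 1)) + (int (C (2 * i + 2)) - int (C (2 * i + 1))))"
    using ds by (simp add: add_diff_eq diff_add_eq)
  also have "\<dots> = int (n * M * (b - 1)) +
      (1 + (\<Sum>i<n. int (C (2 * i + 2)) - int (C (2 * i + 1))))"
    by (simp add: sum.distrib)
  \<comment> \<open>The leading 1 is the term \<open>j = 0\<close> of the alternating sum.\<close>
  also have "1 + (\<Sum>i<n. int (C (2 * i + 2)) - int (C (2 * i + 1))) =
      (\<Sum>j\<le>2 * n. (-1) ^ j * int (C j))"
    unfolding sum_atMost_double by (simp add: C_def)
  also have "\<dots> = 0"
    using choose_alternating_sum[of "2 * n", where 'a = int] \<open>n > 0\<close> by (simp add: C_def)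
  finally show ?thesis by linarith
qed

section \<open>Divisibility by the digit sums\<close>

lemma two_power_mult_dvd_power_diff_1:
  fixes b :: nat
  assumes "odd b"
  shows "2 ^ k * (b - 1) dvd b ^ (2 ^ k) - 1"
proof (induction k)
  case 0
  show ?case by simp
next
  case (Suc k)
  \<comment> \<open>A difference of squares; since \<open>b\<close> is odd, the factor
    \<open>b ^ (2 ^ k) + 1\<close> supplies the additional 2.\<close>
  have "b ^ (2 ^ Suc k) - 1 = (b ^ (2 ^ k) + 1) * (b ^ (2 ^ k) - 1)"
    by (simp add: mult_2 power_add diff_mult_distrib2)
  moreover have "2 dvd b ^ (2 ^ k) + 1"
    using assms by simp
  ultimately show ?case
    unfolding power_Suc mult.assoc by (simp only: mult_dvd_mono Suc.IH)
qed

text \<open>The parity and divisibility conditions on \<open>b\<close> cover both the bases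
  \<open>(4 * l + 2) * p + 1\<close> and those chosen below for the infinitude claim.\<close>

lemma niven_of_degree_power_diff_1:
  fixes b k n p q :: nat
  assumes "b \<ge> 2" "n \<ge> 1" "n = 2 ^ q * p" "(2 * n) choose n \<le> b" "odd b" "p dvd b - 1"
  shows "niven_of_degree (2 * n) b (b ^ (2 ^ k) - 1)"
proof -
  define N where "N = b ^ (2 ^ k) - 1"
  have N: "N > 0"
    using assms(1) one_less_power[of b "2 ^ k"] by (simp add: N_def)
  have dvd: "2 ^ k * (b - 1) dvd N"
    unfolding N_def using assms(5) by (rule two_power_mult_dvd_power_diff_1)
  have "p dvd N"
    using assms(6) dvd dvd_mult_right dvd_trans by blast
  have "q < n"
  proof -
    have "q < 2 ^ q * 1" by simp
    also have "\<dots> \<le> n"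
      unfolding assms(3) using assms(2,3) by (intro mult_le_mono2) (cases p, auto)
    finally show ?thesis .
  qed
  \<comment> \<open>\<open>N\<close> is even because \<open>b\<close> is odd, and
    \<open>q \<le> n - 1 \<le> 2 * n - 2\<close>.\<close>
  then have "(2 :: nat) ^ q dvd N ^ (2 * n - 2)"
    using assms(5) N_def by (intro dvd_trans[OF le_imp_power_dvd dvd_power_same]) auto
  \<comment> \<open>Three separate factors of \<open>N ^ (2 * n)\<close> absorb
    \<open>2 ^ q\<close>, \<open>p\<close> and \<open>2 ^ k * (b - 1)\<close>, so no coprimality is
    required.\<close>
  then have "(2 ^ q * p) * (2 ^ k * (b - 1)) dvd N ^ (2 * n - 2) * N * N"
    using \<open>p dvd N\<close> dvd by (intro mult_dvd_mono)
  moreover have "N ^ (2 * n - 2) * N * N = N ^ (2 * n)"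
    using assms(2) by (cases n) simp_all
  ultimately have "n * 2 ^ k * (b - 1) dvd N ^ (2 * n)"
    by (simp add: assms(3) mult.assoc)
  then have "niven b (N ^ (2 * n))"
    using N digit_sum_power_diff_1_even_power[of b n "2 ^ k"] assms
    by (simp add: niven_def N_def)
  moreover have "niven b N"
    using N dvd digit_sum_power_diff_1[OF assms(1)] by (simp add: niven_def N_def)
  ultimately show ?thesis
    by (simp add: niven_of_degree_def N_def)
qed

section \<open>Infinitely many bases for every even degree\<close>

lemma infinite_bases_niven_of_even_degree:
  fixes m :: nat
  assumes "m \<ge> 2" "even m"
  shows "infinite {b :: nat. b \<ge> 2 \<and>
           (\<exists>N. niven_of_degree m b N \<and> (\<forall>d \<in> set (base_digits b N). d \<noteq> 0))}"
proof -
  obtain n where m: "m = 2 * n"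
    using assms(2) by (auto elim: evenE)
  have n: "n \<ge> 1"
    using assms(1) m by simp
  show ?thesis
    unfolding infinite_nat_iff_unbounded
  proof
    fix x
    \<comment> \<open>The summands of \<open>y\<close> push \<open>b\<close> past both the binomial
      bound and \<open>x\<close>; the factor \<open>2 * n\<close> makes \<open>b - 1\<close> even
      and a multiple of \<open>n\<close>.\<close>
    define y where "y = (2 * n choose n) + x"
    define b where "b = 2 * n * y + 1"
    have "1 * y \<le> 2 * n * y"
      using n by (intro mult_le_mono1) simp
    then have "y < b"
      unfolding b_def by linarith
    moreover have "0 < 2 * n choose n"
      by simp
    ultimately have b: "b \<ge> 2" "b > x" "2 * n choose n \<le> b"
      unfolding y_def by linarith+
    have "odd b" "n dvd b - 1"
      by (simp_all add: b_def)
    \<comment> \<open>The choice \<open>q = 0\<close>, \<open>p = n\<close>, \<open>k = 1\<close>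
      gives the number \<open>b ^ 2 - 1\<close>, both of whose digits are
      \<open>b - 1\<close>.\<close>
    then have "niven_of_degree m b (b ^ (2 ^ 1) - 1)"
      unfolding m using n b by (intro niven_of_degree_power_diff_1[of b n 0 n]) simp_all
    moreover have "\<forall>d \<in> set (base_digits b (b ^ (2 ^ 1) - 1)). d \<noteq> 0"
      using b(1) unfolding base_digits_power_diff_1[OF b(1)] by simp
    ultimately show "\<exists>b>x. b \<in> {b. b \<ge> 2 \<and>
        (\<exists>N. niven_of_degree m b N \<and> (\<forall>d \<in> set (base_digits b N). d \<noteq> 0))}"
      using b by blast
  qed
qed

theorem theorem1:
  shows "(\<forall>b k n p q l :: nat.
            b \<ge> 2 \<longrightarrow> k \<ge> 1 \<longrightarrow> n \<ge> 1 \<longrightarrow>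
            n = 2 ^ q * p \<longrightarrow> odd p \<longrightarrow>
            b \<ge> (2 * n) choose n \<longrightarrow>
            b = (4 * l + 2) * p + 1 \<longrightarrow>
            niven_of_degree (2 * n) b (b ^ (2 ^ k) - 1))
       \<and> (\<forall>m :: nat. m \<ge> 2 \<longrightarrow> even m \<longrightarrow>
            infinite {b :: nat. b \<ge> 2 \<and>
              (\<exists>N. niven_of_degree m b N \<and> (\<forall>d \<in> set (base_digits b N). d \<noteq> 0))})"
proof (intro conjI allI impI)
  fix b k n p q l :: nat
  assume "b \<ge> 2" "n \<ge> 1" "n = 2 ^ q * p" "b \<ge> (2 * n) choose n" and b: "b = (4 * l + 2) * p + 1"
  moreover have "odd b" "p dvd b - 1"
    unfolding b by simp_all
  ultimately show "niven_of_degree (2 * n) b (b ^ (2 ^ k) - 1)"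
    by (intro niven_of_degree_power_diff_1)
qed (rule infinite_bases_niven_of_even_degree)

end
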